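(* Let $\Sigma$ be a sofic subshift and let $G$ be a labelled graph with $\Sigma=\Sigma(G)$. Let $x,y\in\Sigma$. Then $(x,y)\in\mathcal{C}$ (the chain relation of $\Sigma$) if and only if $\omega(x)\leq\alpha(y)$ or $y=\sigma^n(x)$ for some $n>0$.
   Context: Let $A$ be a finite alphabet. $A^{\mathbb Z}$ carries the metric $\rho(x,x)=0$ and, for $x\ne y$, $\rho(x,y)=2^{-n}$, where $n$ is the least nonnegative integer with $x_n\neq y_n$ or $x_{-n}\neq y_{-n}$. The shift is $\sigma(x)_i=x_{i+1}$. A subshift is a closed set $\Sigma\subseteq A^{\mathbb Z}$ with $\sigma(\Sigma)=\Sigma$; it is sofic if the set of all finite factors of its elements is a regular language (equivalently, $\Sigma=\Sigma(G)$ for some labelled graph $G$, see below). Chain relation. For $\epsilon>0$, an $\epsilon$-chain in $\Sigma$ of length $n>0$ from $x^0$ to $x^n$ is a sequence $x^0,x^1,\dots,x^n\in\Sigma$ with $\rho(\sigma(x^i),x^{i+1})<\epsilon$ for all $i=0,1,\dots,n-1$. For $x,y\in\Sigma$, $(x,y)\in\mathcal{C}$ means that for every $\epsilon>0$ there is an $\epsilon$-chain in $\Sigma$ from $x$ to $y$. Labelled graphs. A labelled graph $G$ over $A$ is a finite directed multigraph (loops and parallel edges allowed) whose edges $e$ carry labels $l(e)\in A$. A walk is a sequence of consecutive vertices and edges $v_0e_1v_1\dots e_lv_l$, where $e_{i+1}$ leads from $v_i$ to $v_{i+1}$ (length $l\ge 0$ is allowed); biinfinite walks are defined analogously, indexed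 by $\mathbb Z$. $\Sigma(G)$ is the set of all $x\in A^{\mathbb Z}$ for which there is a biinfinite walk with edges $(e_i)_{i\in\mathbb Z}$ in $G$ with $l(e_i)=x_i$ for all $i$; such a walk is a presentation of $x$. "Connected" means strongly connected, with walks of length zero allowed (a single vertex is connected). The components of a graph are its maximal connected subgraphs; each vertex lies in exactly one. Linking graph. For a vertex $v$ of $G$ lying in the component $K$ of $G$, the restricted follower set $F(v)$ is the set of all finite words spelled by the labels of walks starting at $v$ and staying in $K$. Vertices $v,w$ are linked, $v\sim w$, if $|F(v)\cap F(w)|=\infty$. Let $\approx$ be the transitive and reflexive closure of $\sim$. The linking graph $G/_\approx$ has as vertices the equivalence classes of $\approx$ on $V(G)$, and there is an edge labelled $a$ from class $X$ to class $Y$ iff there are $u\in X$, $v\in Y$ and an edge labelled $a$ from $u$ to $v$ in $G$. Let $\pi:V(G)\to V(G/_\approx)$ be the projection to classes. The components of $G/_\approx$ are partially ordered: $K\geq L$ iff $K$ can be reached from $L$ by a walk in $G/_\approx$. $\alpha$ and $\omega$. Let $x\in\Sigma(G)$ and let $p$ be a presentation of $x$ in $G$ with vertices $(v_i)_{i\in\mathbb Z}$. The vertices $\pi(v_i)$ lie in a single component of $G/_\approx$ for all sufficiently large $i$; this component is $\omega(x)$. They lie in a single component of $G/_\approx$ for all sufficiently small (very negative) $i$; this component is $\alpha(x)$. The components $\alpha(x)$ and $\omega(x)$ do not depend on the choice of the presentation $p$. *)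

theory Defs
  imports "HOL-Analysis.Analysis" "Graph_Theory.Graph_Theory"
begin

section \<open>Subshifts\<close>

text \<open>The alphabet is the finite type \<open>'a\<close>; points of the full shift have type \<open>int \<Rightarrow> 'a\<close>.\<close>

definition rho :: "(int \<Rightarrow> 'a) \<Rightarrow> (int \<Rightarrow> 'a) \<Rightarrow> real" where
  "rho x y = (if x = y then 0
     else (1/2) ^ (LEAST n::nat. x (int n) \<noteq> y (int n) \<or> x (- int n) \<noteq> y (- int n)))"

definition shift :: "(int \<Rightarrow> 'a) \<Rightarrow> (int \<Rightarrow> 'a)" where
  "shift x = (\<lambda>i. x (i + 1))"

definition subshift :: "(int \<Rightarrow> 'a::finite) set \<Rightarrow> bool" where
  "subshift S \<longleftrightarrow> closedin (Metric_space.mtopology UNIV rho) S \<and> shift ` S = S"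

text \<open>The topology \<open>Metric_space.mtopology UNIV rho\<close> is meaningful only because
  \<open>rho\<close> is a metric.\<close>

lemma Metric_space_rho: "Metric_space UNIV (rho :: (int \<Rightarrow> 'a) \<Rightarrow> (int \<Rightarrow> 'a) \<Rightarrow> real)"
proof
  fix x y z :: "int \<Rightarrow> 'a"
  let ?P = "\<lambda>x y n. x (int n) \<noteq> (y (int n) :: 'a) \<or> x (- int n) \<noteq> y (- int n)"
  have ex: "\<exists>n. ?P x y n" if "x \<noteq> y" for x y :: "int \<Rightarrow> 'a"
  proof -
    from that obtain i where i: "x i \<noteq> y i" by auto
    have "i = int (nat i) \<or> i = - int (nat (- i))" by linarith
    with i show ?thesis by metis
  qed
  have nonneg: "0 \<le> rho x y" for x y :: "int \<Rightarrow> 'a"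
    by (simp add: rho_def)
  show "0 \<le> rho x y" by (rule nonneg)
  have "?P x y = ?P y x" by (intro ext) auto
  then show "rho x y = rho y x"
    by (simp only: rho_def eq_commute[of x y])
  show "rho x y = 0 \<longleftrightarrow> x = y"
    by (simp add: rho_def)
  show "rho x z \<le> rho x y + rho y z"
  proof (cases "x = z \<or> x = y \<or> y = z")
    case True
    then show ?thesis
      using nonneg[of x y] nonneg[of y z] by (auto simp: rho_def)
  next
    case False
    define n where "n = (LEAST n. ?P x z n)"
    have "?P x z n" unfolding n_def using LeastI_ex[OF ex] False by blast
    then consider "?P x y n" | "?P y z n" by metis
    then show ?thesis
    proof cases
      case 1
      then have "(LEAST n. ?P x y n) \<le> n" by (rule Least_le)
      then have "(1/2 :: real) ^ n \<le> (1/2) ^ (LEAST n. ?P x y n)"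
        by (intro power_decreasing) auto
      then have "rho x z \<le> rho x y"
        using False by (simp add: rho_def n_def)
      then show ?thesis using nonneg[of y z] by linarith
    next
      case 2
      then have "(LEAST n. ?P y z n) \<le> n" by (rule Least_le)
      then have "(1/2 :: real) ^ n \<le> (1/2) ^ (LEAST n. ?P y z n)"
        by (intro power_decreasing) auto
      then have "rho x z \<le> rho y z"
        using False by (simp add: rho_def n_def)
      then show ?thesis using nonneg[of x y] by linarith
    qed
  qed
qed

definition factors :: "(int \<Rightarrow> 'a) set \<Rightarrow> 'a list set" where
  "factors S = {map (\<lambda>k. x (i + int k)) [0..<n] | x i n. x \<in> S}"

text \<open>Regularity is recognizability by a deterministic finite automaton with states
  \<open>{..<m}\<close>, initial state \<open>q0\<close>, accepting states \<open>F\<close> and transition function \<open>\<delta>\<close>.\<close>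

definition regular_language :: "'a list set \<Rightarrow> bool" where
  "regular_language L \<longleftrightarrow>
     (\<exists>(m::nat) \<delta> q0 F. q0 < m \<and> F \<subseteq> {..<m} \<and> (\<forall>q<m. \<forall>a. \<delta> q a < m) \<and>
        L = {w. foldl \<delta> q0 w \<in> F})"

definition sofic :: "(int \<Rightarrow> 'a::finite) set \<Rightarrow> bool" where
  "sofic S \<longleftrightarrow> subshift S \<and> regular_language (factors S)"


section \<open>The chain relation\<close>

definition is_chain ::
  "(int \<Rightarrow> 'a) set \<Rightarrow> real \<Rightarrow> nat \<Rightarrow> (nat \<Rightarrow> int \<Rightarrow> 'a) \<Rightarrow> bool" where
  "is_chain S \<epsilon> n c \<longleftrightarrow> n > 0 \<and> (\<forall>i\<le>n. c i \<in> S) \<and> (\<forall>i<n. rho (shift (c i)) (c (i + 1)) < \<epsilon>)"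

definition chain_relation :: "(int \<Rightarrow> 'a) set \<Rightarrow> ((int \<Rightarrow> 'a) \<times> (int \<Rightarrow> 'a)) set" where
  "chain_relation S = {(x, y). x \<in> S \<and> y \<in> S \<and>
     (\<forall>\<epsilon>>0. \<exists>n c. is_chain S \<epsilon> n c \<and> c 0 = x \<and> c n = y)}"


section \<open>Labelled graphs and their shifts\<close>

text \<open>A labelled graph is a finite directed multigraph \<open>G\<close> (\<open>fin_digraph G\<close>) together
  with a labelling \<open>l\<close> of its arcs.\<close>

definition is_presentation ::
  "('v, 'e) pre_digraph \<Rightarrow> ('e \<Rightarrow> 'a) \<Rightarrow> (int \<Rightarrow> 'a) \<Rightarrow> (int \<Rightarrow> 'v) \<Rightarrow> (int \<Rightarrow> 'e) \<Rightarrow> bool" where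
  "is_presentation G l x v e \<longleftrightarrow>
     (\<forall>i. v i \<in> verts G \<and> e (i + 1) \<in> arcs G \<and>
          tail G (e (i + 1)) = v i \<and> head G (e (i + 1)) = v (i + 1)) \<and>
     (\<forall>i. l (e i) = x i)"

definition graph_shift :: "('v, 'e) pre_digraph \<Rightarrow> ('e \<Rightarrow> 'a) \<Rightarrow> (int \<Rightarrow> 'a) set" where
  "graph_shift G l = {x. \<exists>v e. is_presentation G l x v e}"


section \<open>The linking graph\<close>

definition restricted_follower ::
  "('v, 'e) pre_digraph \<Rightarrow> ('e \<Rightarrow> 'a) \<Rightarrow> 'v \<Rightarrow> 'a list set" where
  "restricted_follower G l v =
     {map l p | K p w. K \<in> pre_digraph.sccs G \<and> v \<in> verts K \<and> pre_digraph.awalk K v p w}"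

definition linked :: "('v, 'e) pre_digraph \<Rightarrow> ('e \<Rightarrow> 'a) \<Rightarrow> 'v rel" where
  "linked G l = {(v, w). v \<in> verts G \<and> w \<in> verts G \<and>
     infinite (restricted_follower G l v \<inter> restricted_follower G l w)}"

definition link_equiv :: "('v, 'e) pre_digraph \<Rightarrow> ('e \<Rightarrow> 'a) \<Rightarrow> 'v rel" where
  "link_equiv G l = rtrancl_on (verts G) (linked G l)"

definition link_class :: "('v, 'e) pre_digraph \<Rightarrow> ('e \<Rightarrow> 'a) \<Rightarrow> 'v \<Rightarrow> 'v set" where
  "link_class G l v = link_equiv G l `` {v}"

text \<open>An edge labelled \<open>a\<close> from \<open>X\<close> to \<open>Y\<close> in the linking graph is the triple \<open>(X, a, Y)\<close>.\<close>

definition linking_graph ::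
  "('v, 'e) pre_digraph \<Rightarrow> ('e \<Rightarrow> 'a) \<Rightarrow> ('v set, 'v set \<times> 'a \<times> 'v set) pre_digraph" where
  "linking_graph G l =
     \<lparr> verts = verts G // link_equiv G l,
       arcs = {(X, a, Y). X \<in> verts G // link_equiv G l \<and> Y \<in> verts G // link_equiv G l \<and>
                 (\<exists>u\<in>X. \<exists>v\<in>Y. \<exists>e\<in>arcs G. tail G e = u \<and> head G e = v \<and> l e = a)},
       tail = fst,
       head = (\<lambda>(X, a, Y). Y) \<rparr>"

lemma wf_digraph_linking_graph: "wf_digraph (linking_graph G l)"
  by unfold_locales (auto simp: linking_graph_def)

text \<open>\<open>component_le H K L\<close> is the order \<open>K \<le> L\<close> on components of \<open>H\<close>: the larger
  component is the one that can be reached.\<close>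

definition component_le ::
  "('v, 'e) pre_digraph \<Rightarrow> ('v, 'e) pre_digraph \<Rightarrow> ('v, 'e) pre_digraph \<Rightarrow> bool" where
  "component_le H K L \<longleftrightarrow> (\<exists>u\<in>verts K. \<exists>v\<in>verts L. u \<rightarrow>\<^sup>*\<^bsub>H\<^esub> v)"


section \<open>Limit components of a point\<close>

definition omega_comp ::
  "('v, 'e) pre_digraph \<Rightarrow> ('e \<Rightarrow> 'a) \<Rightarrow> (int \<Rightarrow> 'a) \<Rightarrow> ('v set, 'v set \<times> 'a \<times> 'v set) pre_digraph" where
  "omega_comp G l x = (THE K. K \<in> pre_digraph.sccs (linking_graph G l) \<and>
     (\<exists>v e. is_presentation G l x v e \<and> (\<forall>\<^sub>F i in at_top. link_class G l (v i) \<in> verts K)))"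

definition alpha_comp ::
  "('v, 'e) pre_digraph \<Rightarrow> ('e \<Rightarrow> 'a) \<Rightarrow> (int \<Rightarrow> 'a) \<Rightarrow> ('v set, 'v set \<times> 'a \<times> 'v set) pre_digraph" where
  "alpha_comp G l x = (THE K. K \<in> pre_digraph.sccs (linking_graph G l) \<and>
     (\<exists>v e. is_presentation G l x v e \<and> (\<forall>\<^sub>F i in at_bot. link_class G l (v i) \<in> verts K)))"

end

theory Submission
  imports Defs
begin

text \<open>
  For a fixed precision \<open>2 ^ - N\<close>, a chain is a sequence of points each of which shows, in the
  window \<open>[-N, N]\<close>, the shifted word of its predecessor (\<open>chain_relation_iff\<close>). Consecutive
  windows overlap, so a chain follows an orbit and may change to another orbit wherever both
  points share a long enough word.

  The link between chains and the graph is a pigeonhole argument (\<open>linked_in_window\<close>): if two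
  biinfinite walks carry the same labels on an interval longer than the number of pairs of
  vertices, then some pair of vertices is visited twice. Between these visits both walks run
  through cycles with a common label, and the powers of this label show that the two vertices
  are linked. Applied to two presentations of one point this proves that \<open>\<omega>\<close> and \<open>\<alpha>\<close> are well
  defined (\<open>limit_scc_unique\<close>).

  Suppose that \<open>\<omega>(x) \<le> \<alpha>(y)\<close>. A path in the linking graph from a late vertex of \<open>x\<close> to an early
  vertex of \<open>y\<close> consists of arcs and links. Along an arc the chain simply moves on
  (\<open>before_arc\<close>). Linked vertices have long common words inside their components, hence
  two cycles with a long common initial word, and this word lets the chain pass from one cycle to
  the other (\<open>before_linked\<close>).

  Conversely, consider a chain from \<open>x\<close> to \<open>y\<close> with a large window. If its length stays bounded
  while the window grows, then \<open>y\<close> is a shift of \<open>x\<close>. Otherwise choose presentations of all points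
  of the chain and compare the points at distance \<open>h\<close>, the length needed in the pigeonhole
  argument. Neighbours in this selection share a word in which their presentations meet in a class
  of linked vertices. The selection is sparse enough for these meeting times to increase, so the
  pieces of walks between them form a walk in the linking graph from \<open>\<omega>(x)\<close> to \<open>\<alpha>(y)\<close>
  (\<open>reachable_if_chain\<close>).
\<close>

section \<open>Chains seen through finite windows\<close>

lemma rho_less_power_iff:
  "rho a b < (1/2) ^ N \<longleftrightarrow> (\<forall>k. \<bar>k\<bar> \<le> int N \<longrightarrow> a k = b k)"
proof (cases "a = b")
  case True
  then show ?thesis by (simp add: rho_def)
next
  case False
  let ?P = "\<lambda>n. a (int n) \<noteq> b (int n) \<or> a (- int n) \<noteq> b (- int n)"
  have cases_int: "k = int (nat \<bar>k\<bar>) \<or> k = - int (nat \<bar>k\<bar>)" for k :: int by linarith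
  define m where "m = (LEAST n. ?P n)"
  have "\<exists>n. ?P n"
  proof -
    from False obtain k where "a k \<noteq> b k" by auto
    then have "?P (nat \<bar>k\<bar>)" using cases_int[of k] by metis
    then show ?thesis ..
  qed
  then have Pm: "?P m" unfolding m_def by (rule LeastI_ex)
  have least: "m \<le> n" if "?P n" for n unfolding m_def using that by (rule Least_le)
  have "rho a b < (1/2) ^ N \<longleftrightarrow> N < m"
    using False by (simp add: rho_def m_def power_strict_decreasing_iff)
  also have "\<dots> \<longleftrightarrow> (\<forall>k. \<bar>k\<bar> \<le> int N \<longrightarrow> a k = b k)"
  proof
    assume "N < m"
    show "\<forall>k. \<bar>k\<bar> \<le> int N \<longrightarrow> a k = b k"
    proof (intro allI impI, rule ccontr)
      fix k assume k: "\<bar>k\<bar> \<le> int N" "a k \<noteq> b k"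
      then have "?P (nat \<bar>k\<bar>)" using cases_int[of k] by metis
      with least[of "nat \<bar>k\<bar>"] k(1) \<open>N < m\<close> show False by linarith
    qed
  next
    assume "\<forall>k. \<bar>k\<bar> \<le> int N \<longrightarrow> a k = b k"
    then have "\<not> ?P n" if "n \<le> N" for n using that by auto
    with Pm show "N < m" by (meson not_less)
  qed
  finally show ?thesis .
qed

definition window_step ::
  "(int \<Rightarrow> 'a) set \<Rightarrow> nat \<Rightarrow> ((int \<Rightarrow> 'a) \<times> (int \<Rightarrow> 'a)) set" where
  "window_step S N = {(a, b). a \<in> S \<and> b \<in> S \<and> (\<forall>k. \<bar>k\<bar> \<le> int N \<longrightarrow> a (k + 1) = b k)}"

lemma window_step_iff:
  "(a, b) \<in> window_step S N \<longleftrightarrow> a \<in> S \<and> b \<in> S \<and> rho (shift a) b < (1/2) ^ N"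
  by (simp add: window_step_def rho_less_power_iff shift_def)

lemma chain_relation_iff:
  "(x, y) \<in> chain_relation S \<longleftrightarrow> (\<forall>N. (x, y) \<in> (window_step S N)\<^sup>+)"
proof
  assume *: "(x, y) \<in> chain_relation S"
  show "\<forall>N. (x, y) \<in> (window_step S N)\<^sup>+"
  proof
    fix N
    from * have "\<exists>n c. is_chain S ((1/2) ^ N) n c \<and> c 0 = x \<and> c n = y"
      by (simp add: chain_relation_def)
    then obtain n c where c: "is_chain S ((1/2) ^ N) n c" "c 0 = x" "c n = y" by blast
    then have "\<forall>i<n. (c i, c (Suc i)) \<in> window_step S N"
      by (simp add: is_chain_def window_step_iff)
    with c have "(x, y) \<in> window_step S N ^^ n" "n > 0"
      by (auto simp: relpow_fun_conv is_chain_def)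
    then show "(x, y) \<in> (window_step S N)\<^sup>+" by (auto simp: trancl_power)
  qed
next
  assume *: "\<forall>N. (x, y) \<in> (window_step S N)\<^sup>+"
  have chain: "\<exists>n c. is_chain S \<epsilon> n c \<and> c 0 = x \<and> c n = y" if "\<epsilon> > 0" for \<epsilon>
  proof -
    obtain N where N: "(1/2 :: real) ^ N < \<epsilon>"
      using real_arch_pow_inv[OF \<open>\<epsilon> > 0\<close>, of "1/2"] by auto
    from * obtain n where "n > 0" "(x, y) \<in> window_step S N ^^ n"
      by (auto simp: trancl_power)
    then obtain c where c: "c 0 = x" "c n = y" "\<forall>i<n. (c i, c (Suc i)) \<in> window_step S N"
      by (auto simp: relpow_fun_conv)
    have "c i \<in> S" if "i \<le> n" for i
    proof (cases i)
      case 0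
      with c(3) \<open>n > 0\<close> show ?thesis by (auto simp: window_step_iff)
    next
      case (Suc j)
      with c(3) that show ?thesis by (auto simp: window_step_iff)
    qed
    moreover have "rho (shift (c i)) (c (i + 1)) < \<epsilon>" if "i < n" for i
      using c(3) that N by (force simp: window_step_iff)
    ultimately show ?thesis using \<open>n > 0\<close> c by (auto simp: is_chain_def)
  qed
  have "x \<in> S" "y \<in> S"
    using * by (auto elim!: allE[of _ 0] elim: converse_tranclE tranclE simp: window_step_iff)
  with chain show "(x, y) \<in> chain_relation S" by (simp add: chain_relation_def)
qed

definition shift_by :: "int \<Rightarrow> (int \<Rightarrow> 'a) \<Rightarrow> (int \<Rightarrow> 'a)" where
  "shift_by t x = (\<lambda>i. x (i + t))"

lemma shift_by_0 [simp]: "shift_by 0 x = x"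
  by (simp add: shift_by_def)

lemma shift_by_shift_by [simp]: "shift_by s (shift_by t x) = shift_by (s + t) x"
  by (simp add: shift_by_def add.assoc)

lemma shift_funpow: "(shift ^^ n) x = shift_by (int n) x"
  by (induction n) (auto simp: shift_by_def shift_def algebra_simps)

lemma orbit_window_step:
  assumes S: "\<And>t. shift_by t a \<in> S" and "s \<le> t"
  shows "(shift_by s a, shift_by t a) \<in> (window_step S N)\<^sup>*"
  using \<open>s \<le> t\<close>
proof (induction rule: int_ge_induct)
  case (step t)
  have "(shift_by t a, shift_by (t + 1) a) \<in> window_step S N"
    using S by (simp add: window_step_def) (simp add: shift_by_def algebra_simps)
  with step.IH show ?case by (rule rtrancl_into_rtrancl)
qed simp

text \<open>A chain may change from one orbit to another at a moment when the window shows nothing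
  but a stretch common to both points.\<close>

lemma switch_window_step:
  assumes S: "\<And>t. shift_by t a \<in> S" "\<And>t. shift_by t b \<in> S"
    and agree: "\<And>k. m - int N \<le> k \<Longrightarrow> k \<le> m + int N \<Longrightarrow> a k = b k"
    and "s < m" "m \<le> t"
  shows "(shift_by s a, shift_by t b) \<in> (window_step S N)\<^sup>+"
proof -
  have "(shift_by s a, shift_by (m - 1) a) \<in> (window_step S N)\<^sup>*"
    using S(1) \<open>s < m\<close> by (intro orbit_window_step) auto
  moreover have "(shift_by (m - 1) a, shift_by m b) \<in> window_step S N"
    using S by (simp add: window_step_def) (auto simp: shift_by_def intro!: agree)
  moreover have "(shift_by m b, shift_by t b) \<in> (window_step S N)\<^sup>*"
    using S(2) \<open>m \<le> t\<close> by (intro orbit_window_step) auto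
  ultimately show ?thesis by (meson rtrancl_into_trancl1 trancl_rtrancl_trancl)
qed

section \<open>Biinfinite walks\<close>

locale labelled_graph = fin_digraph G for G :: "('v, 'e) pre_digraph" (structure) +
  fixes l :: "'e \<Rightarrow> 'a::finite"
begin

text \<open>As in a presentation, the arc at time \<open>i\<close> ends in the vertex visited at time \<open>i\<close>. The
  arcs determine the vertices, so a presentation is nothing but its sequence of arcs.\<close>

definition biwalk :: "(int \<Rightarrow> 'e) \<Rightarrow> bool" where
  "biwalk e \<longleftrightarrow> (\<forall>i. e i \<in> arcs G \<and> head G (e i) = tail G (e (i + 1)))"

lemma is_presentation_iff:
  "is_presentation G l x v e \<longleftrightarrow> biwalk e \<and> v = (\<lambda>i. head G (e i)) \<and> x = l \<circ> e"
proof
  assume *: "is_presentation G l x v e"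
  then have step: "e (i + 1) \<in> arcs G \<and> tail G (e (i + 1)) = v i \<and> head G (e (i + 1)) = v (i + 1)"
    for i by (simp add: is_presentation_def)
  have "e i \<in> arcs G" "head G (e i) = v i" "head G (e i) = tail G (e (i + 1))" for i
    using step[of "i - 1"] step[of i] by auto
  with * show "biwalk e \<and> v = (\<lambda>i. head G (e i)) \<and> x = l \<circ> e"
    by (auto simp: biwalk_def is_presentation_def)
qed (auto simp: biwalk_def is_presentation_def)

lemma graph_shift_eq: "graph_shift G l = {l \<circ> e |e. biwalk e}"
  by (auto simp: graph_shift_def is_presentation_iff)

lemma biwalk_shift_by: "biwalk e \<Longrightarrow> biwalk (shift_by t e)"
  unfolding biwalk_def shift_by_def by (metis add.assoc add.commute)

lemma label_shift_by: "l \<circ> shift_by t e = shift_by t (l \<circ> e)"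
  by (auto simp: shift_by_def)

lemma shift_by_label_in_graph_shift: "biwalk e \<Longrightarrow> shift_by t (l \<circ> e) \<in> graph_shift G l"
  by (metis (mono_tags, lifting) graph_shift_eq biwalk_shift_by label_shift_by mem_Collect_eq)

lemma biwalk_head_in_verts: "biwalk e \<Longrightarrow> head G (e i) \<in> verts G"
  by (simp add: biwalk_def)

lemma biwalk_awalk:
  assumes "biwalk e"
  shows "awalk (head G (e s)) (map (\<lambda>k. e (s + 1 + int k)) [0..<n]) (head G (e (s + int n)))"
proof (induction n)
  case 0
  with assms show ?case by (simp add: awalk_Nil_iff biwalk_head_in_verts)
next
  case (Suc n)
  have "awalk (head G (e (s + int n))) [e (s + 1 + int n)] (head G (e (s + int (Suc n))))"
    using assms unfolding biwalk_def
    by (auto simp: awalk_simps algebra_simps)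
  from awalk_appendI[OF Suc this] show ?case by simp
qed

lemma awalk_nth:
  assumes "awalk u p v" "i < length p"
  shows "p ! i \<in> arcs G"
    and "tail G (p ! i) = (if i = 0 then u else head G (p ! (i - 1)))"
    and "Suc i = length p \<Longrightarrow> head G (p ! i) = v"
  using assms by (induction p arbitrary: u i) (auto simp: awalk_simps nth_Cons split: nat.splits)

lemma biwalk_through_closed_walk:
  assumes p: "awalk v p v" "p \<noteq> []"
  obtains c where "biwalk c" "head G (c 0) = v"
proof
  let ?n = "int (length p)"
  \<comment> \<open>Position 1 carries the first arc of the cycle, so that the walk is at the base point at time 0.\<close>
  define c where "c = (\<lambda>i. p ! nat ((i - 1) mod ?n))"
  have n: "?n > 0" using p(2) by simp
  have lt: "nat (i mod ?n) < length p" for i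
    using n by (simp add: nat_less_iff)
  show "biwalk c" unfolding biwalk_def
  proof (intro allI conjI)
    fix i
    show "c i \<in> arcs G" unfolding c_def by (rule awalk_nth(1)[OF p(1) lt])
    define r where "r = nat ((i - 1) mod ?n)"
    have r: "r < length p" "int r = (i - 1) mod ?n" unfolding r_def using lt n by auto
    have i: "i mod ?n = (int r + 1) mod ?n" unfolding r(2) by (simp add: mod_add_left_eq)
    show "head G (c i) = tail G (c (i + 1))"
    proof (cases "Suc r = length p")
      case True
      then have "int r + 1 = ?n" by linarith
      then have "i mod ?n = 0" using i by simp
      then have "c (i + 1) = p ! 0" "c i = p ! r" by (auto simp: c_def r_def)
      with awalk_nth(3)[OF p(1) r(1) True] awalk_nth(2)[OF p(1), of 0] p(2) show ?thesis by simp
    next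
      case False
      then have "i mod ?n = int r + 1" using i r(1) by simp
      then have "c (i + 1) = p ! Suc r" "c i = p ! r" by (auto simp: c_def r_def nat_add_distrib)
      with awalk_nth(2)[OF p(1), of "Suc r"] False r(1) show ?thesis by simp
    qed
  qed
  have "(- 1) mod ?n = ?n - 1" using n by (simp add: zmod_minus1)
  then have "nat ((- 1) mod ?n) = length p - 1" by simp
  then show "head G (c 0) = v"
    using awalk_nth(3)[OF p(1), of "length p - 1"] p(2) by (simp add: c_def)
qed

text \<open>A right-infinite walk, encoded with arcs at all integer times so that a biinfinite walk
  is itself the future of the vertex that it visits at time \<open>0\<close>.\<close>

definition future :: "'v \<Rightarrow> (int \<Rightarrow> 'e) \<Rightarrow> bool" where
  "future u f \<longleftrightarrow> tail G (f 1) = u \<and> (\<forall>i\<ge>1. f i \<in> arcs G \<and> head G (f i) = tail G (f (i + 1)))"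

lemma biwalk_future: "biwalk e \<Longrightarrow> future (head G (e 0)) e"
  unfolding future_def biwalk_def by (metis add_0)

lemma future_Cons:
  assumes "future (head G a) f" "a \<in> arcs G"
  shows "future (tail G a) (\<lambda>i. if i \<le> 1 then a else f (i - 1))"
  unfolding future_def
proof (intro conjI allI impI)
  fix i :: int assume "1 \<le> i"
  then show "(if i \<le> 1 then a else f (i - 1)) \<in> arcs G"
    using assms by (auto simp: future_def)
  show "head G (if i \<le> 1 then a else f (i - 1)) = tail G (if i + 1 \<le> 1 then a else f (i + 1 - 1))"
  proof (cases "i = 1")
    case False
    with \<open>1 \<le> i\<close> assms(1)[unfolded future_def] have "head G (f (i - 1)) = tail G (f (i - 1 + 1))"
      by (metis add_le_cancel_right diff_add_cancel dual_order.order_iff_strict zle_diff1_eq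
          zless_imp_add1_zle)
    with False \<open>1 \<le> i\<close> show ?thesis by simp
  qed (use assms in \<open>simp add: future_def\<close>)
qed simp

definition glue :: "(int \<Rightarrow> 'e) \<Rightarrow> 'e list \<Rightarrow> (int \<Rightarrow> 'e) \<Rightarrow> (int \<Rightarrow> 'e)" where
  "glue e p f = (\<lambda>i. if i \<le> 0 then e i
     else if i \<le> int (length p) then p ! nat (i - 1) else f (i - int (length p)))"

lemma biwalk_glue:
  assumes e: "biwalk e" and p: "awalk (head G (e 0)) p u" and f: "future u f"
  shows "biwalk (glue e p f)"
  unfolding biwalk_def
proof (intro allI)
  fix i
  let ?g = "glue e p f" and ?n = "int (length p)"
  have f1: "f j \<in> arcs G" "head G (f j) = tail G (f (j + 1))" if "j \<ge> 1" for j
    using f that by (auto simp: future_def)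
  have fu: "tail G (f 1) = u" using f by (simp add: future_def)
  have e1: "e j \<in> arcs G" "head G (e j) = tail G (e (j + 1))" for j
    using e by (auto simp: biwalk_def)
  consider "i < 0" | "i = 0" "p = []" | "i = 0" "p \<noteq> []" | "0 < i" "i < ?n" | "0 < i" "i = ?n" | "?n < i" "0 < i"
    by (cases "p = []") force+
  then show "?g i \<in> arcs G \<and> head G (?g i) = tail G (?g (i + 1))"
  proof cases
    case 1
    then show ?thesis using e1[of i] by (simp add: glue_def)
  next
    case 2
    then have "u = head G (e 0)" using p by (simp add: awalk_Nil_iff)
    with 2 e1[of 0] fu show ?thesis by (simp add: glue_def)
  next
    case 3
    then have "tail G (p ! 0) = head G (e 0)" using awalk_nth(2)[OF p, of 0] by simp
    moreover have "1 \<le> ?n" using 3 by (cases p) auto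
    ultimately show ?thesis using 3 e1[of 0] by (simp add: glue_def)
  next
    case 4
    define k where "k = nat (i - 1)"
    have k: "i = int k + 1" "Suc k < length p" using 4 by (auto simp: k_def)
    have "?g i = p ! k" "?g (i + 1) = p ! Suc k"
      using k by (auto simp: glue_def nat_add_distrib)
    with awalk_nth(1)[OF p, of k] awalk_nth(2)[OF p, of "Suc k"] k show ?thesis by simp
  next
    case 5
    define k where "k = nat (i - 1)"
    have k: "i = int k + 1" "Suc k = length p" using 5 unfolding k_def by linarith+
    have "?g i = p ! k" "?g (i + 1) = f 1"
      using 5 k(1) by (simp_all add: glue_def algebra_simps flip: k(2))
    with awalk_nth(1)[OF p, of k] awalk_nth(3)[OF p, of "k"] k fu show ?thesis by simp
  next
    case 6
    then have "?g i = f (i - ?n)" "?g (i + 1) = f (i - ?n + 1)" by (auto simp: glue_def algebra_simps)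
    with f1[of "i - ?n"] 6 show ?thesis by simp
  qed
qed

section \<open>Linked vertices\<close>

text \<open>A walk that starts at \<open>v\<close> has stayed in the component of \<open>v\<close> as long as it can return
  to \<open>v\<close> from its end.\<close>

lemma restricted_follower_eq:
  assumes "v \<in> verts G"
  shows "restricted_follower G l v = {map l p |p w. awalk v p w \<and> w \<rightarrow>\<^sup>*\<^bsub>G\<^esub> v}"
proof (intro equalityI subsetI)
  fix u assume "u \<in> restricted_follower G l v"
  then obtain K p w where *: "u = map l p" "K \<in> sccs" "v \<in> verts K" "pre_digraph.awalk K v p w"
    by (auto simp: restricted_follower_def)
  from \<open>K \<in> sccs\<close> have sub: "subgraph K G" and conn: "strongly_connected K"
    by (auto dest: induced_imp_subgraph)
  interpret K: wf_digraph K using sub by (auto simp: subgraph_def)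
  have "awalk v p w" using *(4) sub by (rule subgraph_awalk_imp_awalk)
  moreover have "w \<rightarrow>\<^sup>*\<^bsub>K\<^esub> v"
    using K.awalk_last_in_verts[OF *(4)] *(3) conn by (auto simp: strongly_connected_def)
  then have "w \<rightarrow>\<^sup>*\<^bsub>G\<^esub> v" using sub by (rule reachable_mono)
  ultimately show "u \<in> {map l p |p w. awalk v p w \<and> w \<rightarrow>\<^sup>*\<^bsub>G\<^esub> v}" using *(1) by blast
next
  fix u assume "u \<in> {map l p |p w. awalk v p w \<and> w \<rightarrow>\<^sup>*\<^bsub>G\<^esub> v}"
  then obtain p w where *: "u = map l p" "awalk v p w" "w \<rightarrow>\<^sup>*\<^bsub>G\<^esub> v" by blast
  let ?K = "G \<restriction> scc_of v"
  have v: "v \<in> scc_of v" using assms by (rule in_scc_of_self)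
  have K: "?K \<in> sccs" using assms by (simp add: in_verts_sccsD_sccs scc_of_in_sccs_verts)
  then have "subgraph ?K G" by (auto dest: induced_imp_subgraph)
  then interpret K: wf_digraph ?K by (auto simp: subgraph_def)
  have "K.awalk x p w" if "awalk x p w" "x \<in> scc_of v" for x
    using that
  proof (induction p arbitrary: x)
    case Nil
    then show ?case by (simp add: awalk_Nil_iff K.awalk_Nil_iff)
  next
    case (Cons a p)
    then have a: "a \<in> arcs G" "x = tail G a" "awalk (head G a) p w"
      by (simp_all add: awalk_Cons_iff)
    have "v \<rightarrow>\<^sup>*\<^bsub>G\<^esub> head G a"
      using Cons.prems(2) a(1,2) by (auto simp: scc_of_def intro: reachable_adj_trans in_arcs_imp_in_arcs_ends)
    moreover have "head G a \<rightarrow>\<^sup>*\<^bsub>G\<^esub> v"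
      using reachable_awalkI[OF a(3)] *(3) by (rule reachable_trans)
    ultimately have "head G a \<in> scc_of v" by (simp add: scc_of_def)
    with Cons a show ?case by (simp add: K.awalk_Cons_iff)
  qed
  with * v have "K.awalk v p w" by blast
  with K v *(1) show "u \<in> restricted_follower G l v"
    unfolding restricted_follower_def by (auto intro!: exI[of _ ?K] exI[of _ p])
qed

lemma sym_linked: "sym (linked G l)"
  by (auto simp: sym_def linked_def Int_commute)

text \<open>The powers of a common label of two cycles are infinitely many common words.\<close>

lemma linked_if_closed_walks:
  assumes p: "awalk v p v" and q: "awalk w q w" and eq: "map l p = map l q" and "p \<noteq> []"
  shows "(v, w) \<in> linked G l"
proof -
  let ?pow = "\<lambda>k r. concat (replicate k r)"
  have power: "awalk x (?pow k r) x" if "awalk x r x" for x k r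
    using that by (induction k) (auto simp: awalk_Nil_iff intro: awalk_appendI)
  have vw: "v \<in> verts G" "w \<in> verts G" using p q by auto
  have "map l (?pow k p) = ?pow k (map l p)" "map l (?pow k q) = ?pow k (map l p)" for k
    using eq by (auto simp: map_concat)
  then have "range (\<lambda>k. ?pow k (map l p)) \<subseteq> restricted_follower G l v \<inter> restricted_follower G l w"
    using power[OF p] power[OF q] vw
    by (auto simp: restricted_follower_eq) (metis reachable_refl)+
  moreover have "inj (\<lambda>k. ?pow k (map l p))"
  proof (rule injI)
    fix i j assume "?pow i (map l p) = ?pow j (map l p)"
    then have "length (?pow i (map l p)) = length (?pow j (map l p))" by simp
    with \<open>p \<noteq> []\<close> show "i = j" by (simp add: length_concat sum_list_replicate)
  qed
  then have "infinite (range (\<lambda>k. ?pow k (map l p)))" by (rule range_inj_infinite)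
  ultimately have "infinite (restricted_follower G l v \<inter> restricted_follower G l w)"
    using finite_subset by blast
  with vw show ?thesis by (simp add: linked_def)
qed

text \<open>Over a finite alphabet infinitely many common words include arbitrarily long ones, and walks
  inside a component can be closed up.\<close>

lemma linked_closed_walks:
  assumes "(v, w) \<in> linked G l"
  obtains p r q r' where "awalk v (p @ r) v" "awalk w (q @ r') w" "map l p = map l q" "n \<le> length p"
proof -
  have "finite {u :: 'a list. set u \<subseteq> UNIV \<and> length u \<le> n}"
    by (rule finite_lists_length_le) simp
  moreover have "infinite (restricted_follower G l v \<inter> restricted_follower G l w)"
    and vw: "v \<in> verts G" "w \<in> verts G"
    using assms by (auto simp: linked_def)
  ultimately have "\<not> restricted_follower G l v \<inter> restricted_follower G l w \<subseteq> {u. set u \<subseteq> UNIV \<and> length u \<le> n}"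
    using finite_subset by blast
  then obtain u where u: "u \<in> restricted_follower G l v" "u \<in> restricted_follower G l w" "\<not> length u \<le> n"
    by blast
  from u(1) vw obtain p v' where p: "u = map l p" "awalk v p v'" "v' \<rightarrow>\<^sup>*\<^bsub>G\<^esub> v"
    by (auto simp: restricted_follower_eq)
  from p(3) obtain r where r: "awalk v' r v" by (auto simp: reachable_awalk)
  from u(2) vw obtain q w' where q: "u = map l q" "awalk w q w'" "w' \<rightarrow>\<^sup>*\<^bsub>G\<^esub> w"
    by (auto simp: restricted_follower_eq)
  from q(3) obtain r' where r': "awalk w' r' w" by (auto simp: reachable_awalk)
  show ?thesis
    using that[of p r q r'] awalk_appendI[OF p(2) r] awalk_appendI[OF q(2) r'] p(1) q(1) u(3) by simp
qed

text \<open>There are more moments in the interval than pairs of vertices, so some pair is visited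
  twice. Between the two visits both walks describe cycles, and these carry the same label.\<close>

lemma linked_in_window:
  assumes e: "biwalk e" and f: "biwalk f"
    and h: "card (verts G \<times> verts G) \<le> h"
    and agree: "\<And>k. s < k \<Longrightarrow> k \<le> s + int h \<Longrightarrow> l (e k) = l (f k)"
  obtains t where "s \<le> t" "t \<le> s + int h" "(head G (e t), head G (f t)) \<in> linked G l"
proof -
  let ?pair = "\<lambda>t. (head G (e t), head G (f t))"
  have "?pair ` {s..s + int h} \<subseteq> verts G \<times> verts G"
    using e f by (auto simp: biwalk_head_in_verts)
  then have "card (?pair ` {s..s + int h}) \<le> card (verts G \<times> verts G)"
    by (intro card_mono) auto
  with h have "card (?pair ` {s..s + int h}) < card {s..s + int h}" by simp
  then have "\<not> inj_on ?pair {s..s + int h}" by (rule pigeonhole)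
  then obtain i j where ij: "s \<le> i" "i < j" "j \<le> s + int h" "?pair i = ?pair j"
    unfolding inj_on_def by (metis atLeastAtMost_iff linorder_neqE)
  define n where "n = nat (j - i)"
  have j: "j = i + int n" "n > 0" using ij by (auto simp: n_def)
  have return: "head G (e (i + int n)) = head G (e i)" "head G (f (i + int n)) = head G (f i)"
    using ij(4) j(1) by simp_all
  let ?arcs = "\<lambda>g. map (\<lambda>k. g (i + 1 + int k)) [0..<n]"
  have cycles: "awalk (head G (e i)) (?arcs e) (head G (e i))" "awalk (head G (f i)) (?arcs f) (head G (f i))"
    using biwalk_awalk[OF e, of i n] biwalk_awalk[OF f, of i n] unfolding return .
  have "map l (?arcs e) = map l (?arcs f)"
    using agree ij j by auto
  with cycles have "?pair i \<in> linked G l"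
    using j(2) by (intro linked_if_closed_walks[of _ "?arcs e" _ "?arcs f"]) auto
  with ij that show ?thesis by auto
qed

section \<open>The linking graph\<close>

lemma equiv_link_equiv: "equiv (verts G) (link_equiv G l)"
  unfolding equiv_def refl_on_def link_equiv_def
  by (auto intro!: rtrancl_on_sym sym_linked transI intro: rtrancl_on_trans dest: in_rtrancl_on_in_F)

lemma link_class_self: "v \<in> verts G \<Longrightarrow> v \<in> link_class G l v"
  unfolding link_class_def by (rule equiv_class_self[OF equiv_link_equiv])

lemma link_class_in_verts: "v \<in> verts G \<Longrightarrow> link_class G l v \<in> verts (linking_graph G l)"
  by (simp add: linking_graph_def link_class_def quotientI)

lemma link_class_eqI:
  assumes "(v, w) \<in> linked G l"
  shows "link_class G l v = link_class G l w"
proof -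
  have "(v, w) \<in> link_equiv G l"
    using assms unfolding link_equiv_def
    by (auto intro: rtrancl_on_into_rtrancl_on simp: linked_def)
  then show ?thesis unfolding link_class_def by (rule equiv_class_eq[OF equiv_link_equiv])
qed

lemma link_class_arc:
  assumes "a \<in> arcs G"
  shows "link_class G l (tail G a) \<rightarrow>\<^bsub>linking_graph G l\<^esub> link_class G l (head G a)"
proof -
  let ?H = "linking_graph G l"
  let ?b = "(link_class G l (tail G a), l a, link_class G l (head G a))"
  have "tail G a \<in> link_class G l (tail G a)" "head G a \<in> link_class G l (head G a)"
    using assms by (simp_all add: link_class_self)
  then have "?b \<in> arcs ?H"
    using assms link_class_in_verts[of "tail G a"] link_class_in_verts[of "head G a"]
    by (auto simp: linking_graph_def)
  moreover have "tail ?H ?b = link_class G l (tail G a)" "head ?H ?b = link_class G l (head G a)"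
    by (auto simp: linking_graph_def)
  ultimately show ?thesis
    by (metis wf_digraph.in_arcs_imp_in_arcs_ends wf_digraph_linking_graph)
qed

lemma biwalk_reachable:
  assumes "biwalk e" "s \<le> t"
  shows "link_class G l (head G (e s)) \<rightarrow>\<^sup>*\<^bsub>linking_graph G l\<^esub> link_class G l (head G (e t))"
  using assms(2)
proof (induction rule: int_ge_induct)
  case base
  have "head G (e s) \<in> verts G" using assms(1) by (rule biwalk_head_in_verts)
  from link_class_in_verts[OF this] show ?case
    by (rule wf_digraph.reachable_refl[OF wf_digraph_linking_graph])
next
  case (step t)
  have "e (t + 1) \<in> arcs G" "tail G (e (t + 1)) = head G (e t)"
    using assms(1) by (auto simp: biwalk_def)
  with link_class_arc have "link_class G l (head G (e t)) \<rightarrow>\<^bsub>linking_graph G l\<^esub> link_class G l (head G (e (t + 1)))"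
    by metis
  with step.IH show ?case by (rule wf_digraph.reachable_adj_trans[OF wf_digraph_linking_graph])
qed

text \<open>A walk in the linking graph may leave a class at another vertex than the one at which it
  entered. On the level of vertices it becomes a path made of arcs and links.\<close>

abbreviation arc_or_link :: "'v rel" where
  "arc_or_link \<equiv> arcs_ends G \<union> linked G l"

lemma linking_graph_reachable_lift:
  assumes "X \<rightarrow>\<^sup>*\<^bsub>linking_graph G l\<^esub> Y" "u \<in> X" "v \<in> Y"
  shows "(u, v) \<in> arc_or_link\<^sup>*"
proof -
  have in_class: "(u, v) \<in> arc_or_link\<^sup>*" if "Z \<in> verts (linking_graph G l)" "u \<in> Z" "v \<in> Z" for Z u v
  proof -
    have "(u, v) \<in> link_equiv G l"
      using that in_quotient_imp_in_rel[OF equiv_link_equiv, of Z u v]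
      by (auto simp: linking_graph_def)
    then have "(u, v) \<in> (linked G l)\<^sup>*"
      unfolding link_equiv_def by (rule rtrancl_on_rtranclI)
    then show ?thesis by (rule rtrancl_mono[THEN subsetD, rotated]) simp
  qed
  from assms(1) have "(X, Y) \<in> rtrancl_on (verts (linking_graph G l)) (arcs_ends (linking_graph G l))"
    by (simp add: reachable_def)
  then show ?thesis using assms(3)
  proof (induction arbitrary: v rule: rtrancl_on_induct)
    case base
    with in_class assms(2) show ?case by blast
  next
    case (step Y Z)
    from \<open>(Y, Z) \<in> arcs_ends _\<close> obtain a where "a \<in> arcs G" "tail G a \<in> Y" "head G a \<in> Z"
      by (auto simp: arcs_ends_def arc_to_ends_def linking_graph_def)
    have "(u, tail G a) \<in> arc_or_link\<^sup>*" using \<open>tail G a \<in> Y\<close> by (rule step.IH)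
    also have "(tail G a, head G a) \<in> arc_or_link" using \<open>a \<in> arcs G\<close> in_arcs_imp_in_arcs_ends by blast
    also have "(head G a, v) \<in> arc_or_link\<^sup>*"
      using \<open>Z \<in> verts _\<close> \<open>head G a \<in> Z\<close> \<open>v \<in> Z\<close> by (rule in_class)
    finally show ?case .
  qed
qed

section \<open>Limit components\<close>

text \<open>By finiteness some class \<open>C\<close> is visited for infinitely many times in the direction \<open>F\<close>.
  Whatever is visited between two visits of \<open>C\<close> lies in the component of \<open>C\<close>.\<close>

lemma eventually_in_scc:
  assumes e: "biwalk e" and F: "F = at_top \<or> F = at_bot"
  obtains K where "K \<in> pre_digraph.sccs (linking_graph G l)"
    "\<forall>\<^sub>F i in F. link_class G l (head G (e i)) \<in> verts K"
proof -
  let ?H = "linking_graph G l" and ?c = "\<lambda>i. link_class G l (head G (e i))"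
  interpret H: wf_digraph ?H by (rule wf_digraph_linking_graph)
  have reach: "?c s \<rightarrow>\<^sup>*\<^bsub>?H\<^esub> ?c t" if "s \<le> t" for s t
    using e that by (rule biwalk_reachable)
  have c_verts: "?c i \<in> verts ?H" for i using reach[of i i] H.reachable_in_verts by blast
  have "finite (verts ?H)"
    using finite_quotient[of "verts G" "link_equiv G l"] equiv_type[OF equiv_link_equiv]
    by (simp add: linking_graph_def)
  then obtain C where C: "\<exists>\<^sub>F i in F. ?c i = C"
  proof -
    have "F \<noteq> bot" using F trivial_limit_at_top_linorder trivial_limit_at_bot_linorder by metis
    then have "\<exists>\<^sub>F i in F. \<exists>C\<in>verts ?H. ?c i = C"
      using c_verts \<open>F \<noteq> bot\<close> by (intro eventually_frequently always_eventually) auto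
    from frequently_bex_finite[OF \<open>finite (verts ?H)\<close> this] that show ?thesis by blast
  qed
  from frequently_ex[OF C] c_verts have "C \<in> verts ?H" by auto
  have "\<forall>\<^sub>F i in F. ?c i \<in> H.scc_of C"
    using F
  proof
    assume F: "F = at_top"
    from C obtain i\<^sub>0 where i\<^sub>0: "?c i\<^sub>0 = C" using frequently_ex by blast
    have "?c i \<in> H.scc_of C" if "i \<ge> i\<^sub>0" for i
    proof -
      obtain j where "i \<le> j" "?c j = C"
        using frequently_ex[OF frequently_eventually_frequently[OF C, of "\<lambda>j. i \<le> j"]] F
        by (auto simp: eventually_ge_at_top)
      with reach[OF that] reach[of i j] i\<^sub>0 show ?thesis by (simp add: H.scc_of_def)
    qed
    then show ?thesis using F by (auto simp: eventually_at_top_linorder)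
  next
    assume F: "F = at_bot"
    from C obtain i\<^sub>0 where i\<^sub>0: "?c i\<^sub>0 = C" using frequently_ex by blast
    have "?c i \<in> H.scc_of C" if "i \<le> i\<^sub>0" for i
    proof -
      obtain j where "j \<le> i" "?c j = C"
        using frequently_ex[OF frequently_eventually_frequently[OF C, of "\<lambda>j. j \<le> i"]] F
        by (auto simp: eventually_le_at_bot)
      with reach[OF that] reach[of j i] i\<^sub>0 show ?thesis by (simp add: H.scc_of_def)
    qed
    then show ?thesis using F by (auto simp: eventually_at_bot_linorder)
  qed
  moreover have "?H \<restriction> H.scc_of C \<in> H.sccs"
    using \<open>C \<in> verts ?H\<close> by (simp add: H.in_verts_sccsD_sccs H.scc_of_in_sccs_verts)
  ultimately show ?thesis using that[of "?H \<restriction> H.scc_of C"] by simp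
qed

text \<open>Two presentations of the same point carry equal labels on every interval, so they meet in a
  common class arbitrarily late as well as arbitrarily early. This makes \<open>\<omega>\<close> and \<open>\<alpha>\<close> well
  defined.\<close>

lemma limit_scc_unique:
  assumes e: "biwalk e" and f: "biwalk f" and eq: "l \<circ> e = l \<circ> f" and F: "F = at_top \<or> F = at_bot"
    and K: "K \<in> pre_digraph.sccs (linking_graph G l)" "\<forall>\<^sub>F i in F. link_class G l (head G (e i)) \<in> verts K"
    and L: "L \<in> pre_digraph.sccs (linking_graph G l)" "\<forall>\<^sub>F i in F. link_class G l (head G (f i)) \<in> verts L"
  shows "K = L"
proof -
  interpret H: wf_digraph "linking_graph G l" by (rule wf_digraph_linking_graph)
  let ?h = "card (verts G \<times> verts G)"
  from K(2) L(2) have ev: "\<forall>\<^sub>F i in F. link_class G l (head G (e i)) \<in> verts K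
      \<and> link_class G l (head G (f i)) \<in> verts L" by (rule eventually_conj)
  obtain s where s: "link_class G l (head G (e t)) \<in> verts K \<and> link_class G l (head G (f t)) \<in> verts L"
    if "s \<le> t" "t \<le> s + int ?h" for t
    using F
  proof
    assume "F = at_top"
    with ev that show ?thesis by (auto simp: eventually_at_top_linorder)
  next
    assume "F = at_bot"
    with ev obtain b where "link_class G l (head G (e t)) \<in> verts K \<and> link_class G l (head G (f t)) \<in> verts L"
      if "t \<le> b" for t by (auto simp: eventually_at_bot_linorder)
    with that[of "b - int ?h"] show ?thesis by auto
  qed
  obtain t where t: "s \<le> t" "t \<le> s + int ?h" "(head G (e t), head G (f t)) \<in> linked G l"
    using linked_in_window[OF e f order_refl] fun_cong[OF eq] by (auto simp: comp_def)
  from link_class_eqI[OF t(3)] s[OF t(1,2)] have "verts K \<inter> verts L \<noteq> {}" by auto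
  then show ?thesis using K(1) L(1) H.scc_disj by blast
qed

lemma
  assumes e: "biwalk e"
  shows omega_comp: "omega_comp G l (l \<circ> e) \<in> pre_digraph.sccs (linking_graph G l)"
      "\<forall>\<^sub>F i in at_top. link_class G l (head G (e i)) \<in> verts (omega_comp G l (l \<circ> e))"
    and alpha_comp: "alpha_comp G l (l \<circ> e) \<in> pre_digraph.sccs (linking_graph G l)"
      "\<forall>\<^sub>F i in at_bot. link_class G l (head G (e i)) \<in> verts (alpha_comp G l (l \<circ> e))"
proof -
  let ?H = "linking_graph G l"
  have the: "K = (THE K. K \<in> pre_digraph.sccs ?H \<and>
      (\<exists>v f. is_presentation G l (l \<circ> e) v f \<and> (\<forall>\<^sub>F i in F. link_class G l (v i) \<in> verts K)))"
    if F: "F = at_top \<or> F = at_bot" and K: "K \<in> pre_digraph.sccs ?H"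
      "\<forall>\<^sub>F i in F. link_class G l (head G (e i)) \<in> verts K" for F K
  proof (rule the_equality[symmetric])
    show "K \<in> pre_digraph.sccs ?H \<and>
      (\<exists>v f. is_presentation G l (l \<circ> e) v f \<and> (\<forall>\<^sub>F i in F. link_class G l (v i) \<in> verts K))"
      using e K by (auto simp: is_presentation_iff)
  next
    fix L assume "L \<in> pre_digraph.sccs ?H \<and>
      (\<exists>v f. is_presentation G l (l \<circ> e) v f \<and> (\<forall>\<^sub>F i in F. link_class G l (v i) \<in> verts L))"
    then obtain f where L: "L \<in> pre_digraph.sccs ?H" "biwalk f" "l \<circ> e = l \<circ> f"
      "\<forall>\<^sub>F i in F. link_class G l (head G (f i)) \<in> verts L"
      by (auto simp: is_presentation_iff)
    show "L = K"
      by (rule limit_scc_unique[symmetric]) (use e L F K in auto)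
  qed
  obtain K where K: "K \<in> pre_digraph.sccs ?H" "\<forall>\<^sub>F i in at_top. link_class G l (head G (e i)) \<in> verts K"
    using eventually_in_scc[OF e, of at_top] by blast
  from the[OF _ K] have "omega_comp G l (l \<circ> e) = K" by (simp add: omega_comp_def)
  with K show "omega_comp G l (l \<circ> e) \<in> pre_digraph.sccs ?H"
    "\<forall>\<^sub>F i in at_top. link_class G l (head G (e i)) \<in> verts (omega_comp G l (l \<circ> e))" by auto
  obtain L where L: "L \<in> pre_digraph.sccs ?H" "\<forall>\<^sub>F i in at_bot. link_class G l (head G (e i)) \<in> verts L"
    using eventually_in_scc[OF e, of at_bot] by blast
  from the[OF _ L] have "alpha_comp G l (l \<circ> e) = L" by (simp add: alpha_comp_def)
  with L show "alpha_comp G l (l \<circ> e) \<in> pre_digraph.sccs ?H"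
    "\<forall>\<^sub>F i in at_bot. link_class G l (head G (e i)) \<in> verts (alpha_comp G l (l \<circ> e))" by auto
qed

section \<open>From reachability to chains\<close>

abbreviation step :: "nat \<Rightarrow> ((int \<Rightarrow> 'a) \<times> (int \<Rightarrow> 'a)) set" where
  "step \<equiv> window_step (graph_shift G l)"

lemma switch_biwalk:
  assumes "biwalk e" "biwalk f"
    and "\<And>k. m - int N \<le> k \<Longrightarrow> k \<le> m + int N \<Longrightarrow> l (e k) = l (f k)" and "s < m" "m \<le> t"
  shows "(shift_by s (l \<circ> e), shift_by t (l \<circ> f)) \<in> (step N)\<^sup>+"
  using assms by (intro switch_window_step[where m = m] shift_by_label_in_graph_shift) auto

text \<open>At time \<open>- N - 1\<close> the window and its next position see only times up to \<open>0\<close>. A point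
  observed then can still be redirected arbitrarily after the vertex that it visits at time \<open>0\<close>.\<close>

definition before :: "nat \<Rightarrow> (int \<Rightarrow> 'e) \<Rightarrow> (int \<Rightarrow> 'a)" where
  "before N e = shift_by (- int N - 1) (l \<circ> e)"

lemma before_arc:
  assumes e: "biwalk e" "head G (e 0) = tail G a" and a: "a \<in> arcs G" and f: "future (head G a) f"
  obtains e' where "biwalk e'" "head G (e' 0) = head G a" "(before N e, before N e') \<in> (step N)\<^sup>+"
proof
  let ?g = "glue e [a] f"
  have g: "biwalk ?g"
    using e a f by (intro biwalk_glue[of _ _ "head G a"]) (auto simp: awalk_simps)
  then show "biwalk (shift_by 1 ?g)" by (rule biwalk_shift_by)
  show "head G (shift_by 1 ?g 0) = head G a" by (simp add: shift_by_def glue_def)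
  have "(shift_by (- int N - 1) (l \<circ> e), shift_by (- int N) (l \<circ> ?g)) \<in> (step N)\<^sup>+"
    by (rule switch_biwalk[OF e(1) g, where m = "- int N"]) (auto simp: glue_def)
  then show "(before N e, before N (shift_by 1 ?g)) \<in> (step N)\<^sup>+"
    by (simp add: before_def label_shift_by)
qed

text \<open>Both vertices lie on cycles that begin with the same long word. The chain follows this
  word along the first cycle, changes over to the second cycle when the window sees nothing but
  the word, and closes the second cycle.\<close>

lemma before_linked:
  assumes e: "biwalk e" "head G (e 0) = v" and vw: "(v, w) \<in> linked G l"
  obtains e' where "biwalk e'" "head G (e' 0) = w" "(before N e, before N e') \<in> (step N)\<^sup>+"
proof -
  obtain p r q r' where p: "awalk v (p @ r) v" and q: "awalk w (q @ r') w"
    and eq: "map l p = map l q" and long: "2 * N + 2 \<le> length p"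
    using linked_closed_walks[OF vw] by blast
  from eq have len: "length q = length p" by (metis length_map)
  have "q @ r' \<noteq> []" using long len by auto
  then obtain c where c: "biwalk c" "head G (c 0) = w"
    using biwalk_through_closed_walk[OF q] by blast
  define g where "g = glue e (p @ r) e"
  define g' where "g' = glue c (q @ r') c"
  let ?m = "int (length (q @ r'))"
  have g: "biwalk g"
    unfolding g_def using e p biwalk_future[OF e(1)] by (intro biwalk_glue[of _ _ v]) auto
  have g': "biwalk g'"
    unfolding g'_def using c q biwalk_future[OF c(1)] by (intro biwalk_glue[of _ _ w]) auto
  have "(before N e, shift_by (- int N) (l \<circ> g)) \<in> (step N)\<^sup>+"
    unfolding before_def
    by (rule switch_biwalk[OF e(1) g, where m = "- int N"]) (auto simp: g_def glue_def)
  also have "(shift_by (- int N) (l \<circ> g), shift_by (?m - int N - 1) (l \<circ> g')) \<in> (step N)\<^sup>+"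
  proof (rule switch_biwalk[OF g g', where m = "int N + 1"])
    fix k assume k: "int N + 1 - int N \<le> k" "k \<le> int N + 1 + int N"
    define i where "i = nat (k - 1)"
    have i: "k = int i + 1" "i < length p" using k long by (auto simp: i_def)
    have "g k = p ! i" "g' k = q ! i"
      using i len by (auto simp: g_def g'_def glue_def nth_append)
    moreover have "l (p ! i) = l (q ! i)" using eq i(2) len by (metis nth_map)
    ultimately show "l (g k) = l (g' k)" by simp
  qed (use long len in auto)
  also have "shift_by (?m - int N - 1) (l \<circ> g') = before N (shift_by ?m g')"
    by (simp add: before_def label_shift_by algebra_simps)
  finally have "(before N e, before N (shift_by ?m g')) \<in> (step N)\<^sup>+" .
  moreover have "head G (shift_by ?m g' 0) = w"
  proof -
    have "?m > 0" using long len by simp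
    then have "shift_by ?m g' 0 = (q @ r') ! (length (q @ r') - 1)"
      by (simp only: shift_by_def g'_def glue_def) (auto simp: nat_diff_distrib' simp flip: of_nat_add)
    then show ?thesis
      using awalk_nth(3)[OF q, of "length (q @ r') - 1"] \<open>q @ r' \<noteq> []\<close> by simp
  qed
  ultimately show ?thesis using that biwalk_shift_by[OF g'] by blast
qed

text \<open>Following an arc leads to a point of the subshift only if the head of the arc has a
  future. Therefore the induction, which runs backwards from \<open>w\<close>, also carries along that the
  vertices of the path have futures.\<close>

lemma before_reachable:
  assumes "(v, w) \<in> arc_or_link\<^sup>*" and f: "future w f"
  shows "(\<exists>f'. future v f') \<and> (\<forall>e. biwalk e \<and> head G (e 0) = v \<longrightarrow>
    (\<exists>e'. biwalk e' \<and> head G (e' 0) = w \<and> (before N e, before N e') \<in> (step N)\<^sup>*))"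
  using assms(1)
proof (induction rule: converse_rtrancl_induct)
  case base
  with f show ?case by blast
next
  case (step v v')
  then obtain f' where f': "future v' f'" by blast
  have move: "(\<exists>f. future v f) \<and> (\<forall>e. biwalk e \<and> head G (e 0) = v \<longrightarrow>
    (\<exists>e'. biwalk e' \<and> head G (e' 0) = v' \<and> (before N e, before N e') \<in> (step N)\<^sup>*))"
    using step.hyps(1)
  proof
    assume "(v, v') \<in> arcs_ends G"
    then obtain a where a: "a \<in> arcs G" "tail G a = v" "head G a = v'"
      by (auto simp: arcs_ends_def arc_to_ends_def)
    with f' have "future (head G a) f'" by simp
    with a show ?thesis
      using future_Cons[of a f'] before_arc[of _ a f' N] by (metis trancl_into_rtrancl)
  next
    assume vv': "(v, v') \<in> linked G l"
    obtain p r where p: "awalk v (p @ r) v" and "1 \<le> length p"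
      using linked_closed_walks[OF vv', of 1] by blast
    then have "p @ r \<noteq> []" by auto
    with p obtain c where "biwalk c" "head G (c 0) = v"
      using biwalk_through_closed_walk by blast
    then have "\<exists>f. future v f" using biwalk_future by metis
    moreover have "\<exists>e'. biwalk e' \<and> head G (e' 0) = v' \<and> (before N e, before N e') \<in> (step N)\<^sup>*"
      if "biwalk e" "head G (e 0) = v" for e
      using before_linked[OF that vv', of N] by (metis trancl_into_rtrancl)
    ultimately show ?thesis by blast
  qed
  show ?case
  proof (intro conjI allI impI)
    show "\<exists>f. future v f" using move ..
    fix e assume "biwalk e \<and> head G (e 0) = v"
    with move obtain e' where e': "biwalk e'" "head G (e' 0) = v'" "(before N e, before N e') \<in> (step N)\<^sup>*"
      by blast
    with step.IH obtain e'' where "biwalk e''" "head G (e'' 0) = w" "(before N e', before N e'') \<in> (step N)\<^sup>*"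
      by blast
    with e'(3) show "\<exists>e''. biwalk e'' \<and> head G (e'' 0) = w \<and> (before N e, before N e'') \<in> (step N)\<^sup>*"
      using rtrancl_trans by fast
  qed
qed

text \<open>Run along \<open>l \<circ> e\<close> until shortly before time \<open>i\<close>, move along the path of arcs and links, and
  change over to \<open>l \<circ> f\<close> after time \<open>j\<close>. The bound on \<open>j\<close> makes this happen before \<open>f\<close> reaches
  time \<open>0\<close>, that is, before the chain has to end in \<open>l \<circ> f\<close>.\<close>

lemma chain_if_reachable:
  assumes e: "biwalk e" and f: "biwalk f"
    and i: "int N + 1 \<le> i" and j: "j \<le> - int N - 1"
    and reach: "(head G (e i), head G (f j)) \<in> arc_or_link\<^sup>*"
  shows "(l \<circ> e, l \<circ> f) \<in> (step N)\<^sup>+"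
proof -
  let ?e = "shift_by i e" and ?f = "shift_by j f"
  have e': "biwalk ?e" "head G (?e 0) = head G (e i)"
    and f': "biwalk ?f" "head G (?f 0) = head G (f j)"
    using e f by (auto simp: biwalk_shift_by) (auto simp: shift_by_def)
  have future: "future (head G (f j)) ?f" using biwalk_future[OF f'(1)] f'(2) by simp
  with before_reachable[OF reach] e' obtain g
    where g: "biwalk g" "head G (g 0) = head G (f j)" "(before N ?e, before N g) \<in> (step N)\<^sup>*"
    by blast
  define g' where "g' = glue g [] ?f"
  have g': "biwalk g'"
    unfolding g'_def using g(1,2) future biwalk_head_in_verts[OF f]
    by (intro biwalk_glue[of _ _ "head G (f j)"]) (auto simp: awalk_Nil_iff)
  have "(shift_by 0 (l \<circ> e), shift_by (i - int N - 1) (l \<circ> e)) \<in> (step N)\<^sup>*"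
    using e i by (intro orbit_window_step shift_by_label_in_graph_shift) auto
  then have "(l \<circ> e, before N ?e) \<in> (step N)\<^sup>*"
    by (simp add: before_def label_shift_by algebra_simps)
  also note g(3)
  also have "(before N g, shift_by (- int N) (l \<circ> g')) \<in> (step N)\<^sup>+"
    unfolding before_def
    by (rule switch_biwalk[OF g(1) g', where m = "- int N"]) (auto simp: g'_def glue_def)
  also have "(shift_by (- int N) (l \<circ> g'), shift_by (- j) (l \<circ> ?f)) \<in> (step N)\<^sup>+"
    using j by (intro switch_biwalk[OF g' f'(1), where m = "int N + 1"]) (auto simp: g'_def glue_def)
  also have "shift_by (- j) (l \<circ> ?f) = l \<circ> f"
    by (simp add: label_shift_by)
  finally show ?thesis .
qed

lemma chain_if_component_le:
  assumes e: "biwalk e" and f: "biwalk f"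
    and le: "component_le (linking_graph G l) (omega_comp G l (l \<circ> e)) (alpha_comp G l (l \<circ> f))"
  shows "(l \<circ> e, l \<circ> f) \<in> chain_relation (graph_shift G l)"
  unfolding chain_relation_iff
proof
  fix N
  let ?H = "linking_graph G l" and ?K = "omega_comp G l (l \<circ> e)" and ?L = "alpha_comp G l (l \<circ> f)"
  interpret H: wf_digraph ?H by (rule wf_digraph_linking_graph)
  obtain T where T: "link_class G l (head G (e i)) \<in> verts ?K" if "T \<le> i" for i
    using omega_comp(2)[OF e] by (auto simp: eventually_at_top_linorder)
  obtain T' where T': "link_class G l (head G (f j)) \<in> verts ?L" if "j \<le> T'" for j
    using alpha_comp(2)[OF f] by (auto simp: eventually_at_bot_linorder)
  define i where "i = max T (int N + 1)"
  define j where "j = min T' (- int N - 1)"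
  obtain X Y where XY: "X \<in> verts ?K" "Y \<in> verts ?L" "X \<rightarrow>\<^sup>*\<^bsub>?H\<^esub> Y"
    using le by (auto simp: component_le_def)
  have within: "U \<rightarrow>\<^sup>*\<^bsub>?H\<^esub> V" if "K \<in> H.sccs" "U \<in> verts K" "V \<in> verts K" for K U V
  proof (rule H.reachable_mono)
    show "U \<rightarrow>\<^sup>*\<^bsub>K\<^esub> V" using that by (auto simp: strongly_connected_def)
    show "subgraph K ?H" using that(1) by (auto dest: induced_imp_subgraph)
  qed
  have "link_class G l (head G (e i)) \<rightarrow>\<^sup>*\<^bsub>?H\<^esub> X"
    using omega_comp(1)[OF e] T[of i] XY(1) by (intro within) (auto simp: i_def)
  also note XY(3)
  also have "Y \<rightarrow>\<^sup>*\<^bsub>?H\<^esub> link_class G l (head G (f j))"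
    using alpha_comp(1)[OF f] XY(2) T'[of j] by (intro within) (auto simp: j_def)
  finally have "(head G (e i), head G (f j)) \<in> arc_or_link\<^sup>*"
    using e f by (rule_tac linking_graph_reachable_lift) (auto intro!: link_class_self biwalk_head_in_verts)
  then show "(l \<circ> e, l \<circ> f) \<in> (step N)\<^sup>+"
    using e f by (intro chain_if_reachable) (auto simp: i_def j_def)
qed

section \<open>From chains to reachability\<close>

text \<open>Every step moves the visible word by one place, so a symbol can be followed as long as it
  stays in the window.\<close>

lemma window_chain_shift:
  assumes step: "\<And>i k. i < n \<Longrightarrow> \<bar>k\<bar> \<le> int N \<Longrightarrow> c i (k + 1) = c (Suc i) k"
    and "i + d \<le> n" "- int N \<le> k" "k + int d \<le> int N"
  shows "c i (k + int d) = c (i + d) k"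
  using assms(2-)
proof (induction d arbitrary: i)
  case (Suc d)
  have "c i (k + int (Suc d)) = c i ((k + int d) + 1)" by (simp add: algebra_simps)
  also have "\<dots> = c (Suc i) (k + int d)" using Suc.prems by (intro step) auto
  also have "\<dots> = c (Suc i + d) k" using Suc.prems by (intro Suc.IH) auto
  finally show ?case by simp
qed simp

text \<open>Write \<open>\<kappa> i t\<close> for the class that the \<open>i\<close>-th point of the chain visits at time \<open>t\<close>, where
  time \<open>t\<close> of the \<open>i\<close>-th point counts from the start of the chain. Two points at most \<open>N\<close> steps
  apart agree on a common stretch and meet in a class there; comparing only every \<open>h\<close>-th point
  makes the meeting times increase.\<close>

lemma reachable_if_chain:
  assumes h: "card (verts G \<times> verts G) \<le> h"
    and E: "\<And>i. i \<le> n \<Longrightarrow> biwalk (E i)"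
    and step: "\<And>i k. i < n \<Longrightarrow> \<bar>k\<bar> \<le> int N \<Longrightarrow> l (E i (k + 1)) = l (E (Suc i) k)"
    and "0 < h" and N: "T + 2 * h \<le> N" and n: "2 * T + 2 * h \<le> n"
  shows "link_class G l (head G (E 0 (int T))) \<rightarrow>\<^sup>*\<^bsub>linking_graph G l\<^esub>
    link_class G l (head G (E n (- int T)))"
proof -
  interpret H: wf_digraph "linking_graph G l" by (rule wf_digraph_linking_graph)
  define \<kappa> where "\<kappa> i t = link_class G l (head G (E i (int t - int i)))" for i t
  have forward: "\<kappa> i s \<rightarrow>\<^sup>*\<^bsub>linking_graph G l\<^esub> \<kappa> i t" if "i \<le> n" "s \<le> t" for i s t
    unfolding \<kappa>_def using that by (intro biwalk_reachable E) auto
  have meet: "\<exists>t. s \<le> t \<and> t \<le> s + h \<and> \<kappa> i t = \<kappa> j t"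
    if "i \<le> j" "j \<le> n" "j \<le> s + N" "s + h \<le> i + N" for i j s
  proof -
    have agree: "l (shift_by (- int i) (E i) k) = l (shift_by (- int j) (E j) k)"
      if "int s < k" "k \<le> int s + int h" for k
    proof -
      have "l (E i ((k - int j) + int (j - i))) = l (E (i + (j - i)) (k - int j))"
        using that \<open>i \<le> j\<close> \<open>j \<le> n\<close> \<open>j \<le> s + N\<close> \<open>s + h \<le> i + N\<close>
        by (intro window_chain_shift[where c = "\<lambda>i k. l (E i k)" and n = n and N = N] step) auto
      with \<open>i \<le> j\<close> show ?thesis by (simp add: shift_by_def)
    qed
    have "biwalk (shift_by (- int i) (E i))" "biwalk (shift_by (- int j) (E j))"
      using \<open>i \<le> j\<close> \<open>j \<le> n\<close> by (auto intro!: biwalk_shift_by E)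
    from linked_in_window[OF this h agree] obtain t where t: "int s \<le> t" "t \<le> int s + int h"
      "(head G (shift_by (- int i) (E i) t), head G (shift_by (- int j) (E j) t)) \<in> linked G l"
      by blast
    define u where "u = nat t"
    have "t = int u" "s \<le> u" "u \<le> s + h" using t(1,2) by (auto simp: u_def)
    with link_class_eqI[OF t(3)] show ?thesis
      by (auto simp: \<kappa>_def shift_by_def)
  qed
  have along: "\<kappa> 0 T \<rightarrow>\<^sup>*\<^bsub>linking_graph G l\<^esub> \<kappa> (T + Suc k * h) (T + Suc k * h)"
    if "T + Suc k * h \<le> n" for k
    using that
  proof (induction k)
    case 0
    then obtain t where t: "T \<le> t" "t \<le> T + h" "\<kappa> 0 t = \<kappa> (T + h) t"
      using meet[of 0 "T + h" T] N by auto
    have "\<kappa> 0 T \<rightarrow>\<^sup>*\<^bsub>linking_graph G l\<^esub> \<kappa> (T + h) t" using forward[of 0 T t] t by simp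
    also have "\<kappa> (T + h) t \<rightarrow>\<^sup>*\<^bsub>linking_graph G l\<^esub> \<kappa> (T + h) (T + h)"
      using 0 t by (intro forward) auto
    finally show ?case by simp
  next
    case (Suc k)
    let ?i = "T + Suc k * h"
    obtain t where t: "?i \<le> t" "t \<le> ?i + h" "\<kappa> ?i t = \<kappa> (?i + h) t"
      using meet[of ?i "?i + h" ?i] N Suc.prems by auto
    have "\<kappa> 0 T \<rightarrow>\<^sup>*\<^bsub>linking_graph G l\<^esub> \<kappa> ?i ?i" using Suc by simp
    also have "\<kappa> ?i ?i \<rightarrow>\<^sup>*\<^bsub>linking_graph G l\<^esub> \<kappa> (?i + h) t"
      using forward[of ?i ?i t] t Suc.prems by simp
    also have "\<kappa> (?i + h) t \<rightarrow>\<^sup>*\<^bsub>linking_graph G l\<^esub> \<kappa> (?i + h) (?i + h)"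
      using t Suc.prems by (intro forward) auto
    also have "?i + h = T + Suc (Suc k) * h" by simp
    finally show ?case .
  qed
  \<comment> \<open>The last of the points \<open>T + h\<close>, \<open>T + 2 * h\<close>, \<dots> whose meeting with the end point of the
    chain is sure to happen before time \<open>n - T\<close>.\<close>
  define k where "k = (n - 2 * T - 2 * h) div h"
  define i where "i = T + Suc k * h"
  have "k * h \<le> n - 2 * T - 2 * h" "n - 2 * T - 2 * h < k * h + h"
    using \<open>0 < h\<close> by (auto simp: k_def) (metis add.commute dividend_less_div_times)
  with n have i: "i + h + T \<le> n" "n < i + 2 * h + T" by (auto simp: i_def)
  obtain t where t: "i \<le> t" "t \<le> i + h" "\<kappa> i t = \<kappa> n t"
    using meet[of i n i] i N by auto
  have "\<kappa> 0 T \<rightarrow>\<^sup>*\<^bsub>linking_graph G l\<^esub> \<kappa> i i" using along[of k] i by (simp add: i_def)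
  also have "\<kappa> i i \<rightarrow>\<^sup>*\<^bsub>linking_graph G l\<^esub> \<kappa> n t" using forward[of i i t] t i by simp
  also have "\<kappa> n t \<rightarrow>\<^sup>*\<^bsub>linking_graph G l\<^esub> \<kappa> n (n - T)" using forward[of n t "n - T"] t i by simp
  finally show ?thesis using i by (simp add: \<kappa>_def)
qed

text \<open>Chains of bounded length for all window sizes would exhibit \<open>l \<circ> f\<close> as a shift of
  \<open>l \<circ> e\<close>. So for a large window the chain is long enough to separate the late part of \<open>e\<close> from the early
  part of \<open>f\<close>.\<close>

lemma component_le_if_chain:
  assumes e: "biwalk e" and f: "biwalk f"
    and chain: "(l \<circ> e, l \<circ> f) \<in> chain_relation (graph_shift G l)"
    and no_shift: "\<And>n. n > 0 \<Longrightarrow> l \<circ> f \<noteq> shift_by (int n) (l \<circ> e)"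
  shows "component_le (linking_graph G l) (omega_comp G l (l \<circ> e)) (alpha_comp G l (l \<circ> f))"
proof -
  let ?K = "omega_comp G l (l \<circ> e)" and ?L = "alpha_comp G l (l \<circ> f)"
  obtain T\<^sub>e where T\<^sub>e: "link_class G l (head G (e i)) \<in> verts ?K" if "T\<^sub>e \<le> i" for i
    using omega_comp(2)[OF e] by (auto simp: eventually_at_top_linorder)
  obtain T\<^sub>f where T\<^sub>f: "link_class G l (head G (f i)) \<in> verts ?L" if "i \<le> T\<^sub>f" for i
    using alpha_comp(2)[OF f] by (auto simp: eventually_at_bot_linorder)
  define T where "T = nat (max T\<^sub>e (- T\<^sub>f))"
  have T: "T\<^sub>e \<le> int T" "- int T \<le> T\<^sub>f" by (auto simp: T_def)
  define h where "h = Suc (card (verts G \<times> verts G))"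
  define B where "B = 2 * T + 2 * h"
  \<comment> \<open>For each \<open>n < B\<close> some coordinate distinguishes \<open>l \<circ> f\<close> from the \<open>n\<close>-th shift of \<open>l \<circ> e\<close>.
    A window that sees all these coordinates forces chains to have length at least \<open>B\<close>.\<close>
  have "\<forall>n. \<exists>k. n > 0 \<longrightarrow> l (f k) \<noteq> l (e (k + int n))"
    using no_shift by (auto simp: shift_by_def fun_eq_iff)
  then obtain d where d: "\<And>n. n > 0 \<Longrightarrow> l (f (d n)) \<noteq> l (e (d n + int n))" by metis
  define D where "D = (\<Sum>n<B. nat \<bar>d n\<bar>)"
  define N where "N = B + D"
  have d_le: "\<bar>d n\<bar> \<le> int N - int B" if "n < B" for n
  proof -
    have "nat \<bar>d n\<bar> \<le> D" unfolding D_def using that by (intro member_le_sum) auto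
    then show ?thesis by (simp add: N_def)
  qed
  from chain have "(l \<circ> e, l \<circ> f) \<in> (step N)\<^sup>+" by (simp add: chain_relation_iff)
  then obtain n where n: "n > 0" and "(l \<circ> e, l \<circ> f) \<in> step N ^^ n"
    by (auto simp: trancl_power)
  then obtain c where c: "c 0 = l \<circ> e" "c n = l \<circ> f" "\<forall>i<n. (c i, c (Suc i)) \<in> step N"
    by (auto simp: relpow_fun_conv)
  have step: "c i (k + 1) = c (Suc i) k" if "i < n" "\<bar>k\<bar> \<le> int N" for i k
    using c(3) that by (auto simp: window_step_def)
  have "B \<le> n"
  proof (rule ccontr)
    assume "\<not> B \<le> n"
    then have "c 0 (d n + int n) = c (0 + n) (d n)"
      using d_le[of n] by (intro window_chain_shift[where n = n and N = N] step) auto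
    with d[OF n] c show False by simp
  qed
  have "\<exists>g. biwalk g \<and> l \<circ> g = c i \<and> (i = 0 \<longrightarrow> g = e) \<and> (i = n \<longrightarrow> g = f)" if "i \<le> n" for i
  proof -
    consider "i = 0" | "i = n" | "0 < i" "i < n" using \<open>i \<le> n\<close> by linarith
    then show ?thesis
    proof cases
      case 3
      then have "c i \<in> graph_shift G l" using c(3) by (auto simp: window_step_def)
      with 3 show ?thesis by (auto simp: graph_shift_eq)
    qed (use e f c n in auto)
  qed
  then obtain E where E: "\<And>i. i \<le> n \<Longrightarrow> biwalk (E i)" "\<And>i. i \<le> n \<Longrightarrow> l \<circ> E i = c i" "E 0 = e" "E n = f"
    by (metis order_refl zero_le)
  have label: "l (E i k) = c i k" if "i \<le> n" for i k
    using fun_cong[OF E(2)[OF that], of k] by simp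
  have "link_class G l (head G (E 0 (int T))) \<rightarrow>\<^sup>*\<^bsub>linking_graph G l\<^esub>
      link_class G l (head G (E n (- int T)))"
  proof (rule reachable_if_chain[where h = h and N = N])
    show "l (E i (k + 1)) = l (E (Suc i) k)" if "i < n" "\<bar>k\<bar> \<le> int N" for i k
      using step[OF that] label[of i] label[of "Suc i"] that(1) by simp
  qed (use E(1) \<open>B \<le> n\<close> in \<open>auto simp: h_def B_def N_def\<close>)
  with T\<^sub>e T\<^sub>f T E(3,4) show ?thesis by (auto simp: component_le_def)
qed

end

theorem mainTheorem1:
  fixes G :: "('v, 'e) pre_digraph" and l :: "'e \<Rightarrow> 'a::finite"
    and S :: "(int \<Rightarrow> 'a) set" and x y :: "int \<Rightarrow> 'a"
  assumes "sofic S"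
    and "fin_digraph G"
    and "S = graph_shift G l"
    and "x \<in> S" and "y \<in> S"
  shows "(x, y) \<in> chain_relation S \<longleftrightarrow>
    component_le (linking_graph G l) (omega_comp G l x) (alpha_comp G l y) \<or>
    (\<exists>n>0. y = (shift ^^ n) x)"
proof -
  interpret labelled_graph G l using assms(2) by (simp add: labelled_graph_def)
  obtain e f where e: "biwalk e" "x = l \<circ> e" and f: "biwalk f" "y = l \<circ> f"
    using assms by (auto simp: graph_shift_eq)
  have "(x, y) \<in> chain_relation S" if n: "n > 0" "y = (shift ^^ n) x" for n
    unfolding chain_relation_iff
  proof
    fix N
    have "(shift_by 0 x, shift_by (int n) x) \<in> (window_step S N)\<^sup>+"
      using n(1) e assms(3)
      by (intro switch_window_step[where m = "int n"]) (auto simp: shift_by_label_in_graph_shift)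
    then show "(x, y) \<in> (window_step S N)\<^sup>+" using n(2) by (simp add: shift_funpow)
  qed
  moreover have "(x, y) \<in> chain_relation S"
    if "component_le (linking_graph G l) (omega_comp G l x) (alpha_comp G l y)"
    using chain_if_component_le[OF e(1) f(1)] that e f assms(3) by simp
  moreover have "component_le (linking_graph G l) (omega_comp G l x) (alpha_comp G l y)"
    if "(x, y) \<in> chain_relation S" "\<nexists>n. n > 0 \<and> y = (shift ^^ n) x"
    unfolding e(2) f(2)
  proof (rule component_le_if_chain[OF e(1) f(1)])
    show "(l \<circ> e, l \<circ> f) \<in> chain_relation (graph_shift G l)" using that(1) e f assms(3) by simp
    show "l \<circ> f \<noteq> shift_by (int n) (l \<circ> e)" if "n > 0" for n
      using \<open>\<nexists>n. n > 0 \<and> y = (shift ^^ n) x\<close> that unfolding e(2) f(2) shift_funpow by blast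
  qed
  ultimately show ?thesis by blast
qed

end
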